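(* Let $(Z_1,Z_0,\varphi)$ be a Zinbiel 2-algebra, let $E_1,E_0$ be vector spaces such that $Z_i$ is a subspace of $E_i$, and let $(V_1,V_0,d)$ be a 2-vector space with $V_i$ a complement of $Z_i$ in $E_i$ ($i=0,1$), so $E_i=Z_i\oplus V_i$. Then: (1) Put $\mathcal{HE}^2(V,Z):=\mathcal{Z}(Z,V)/\equiv$. The map $\mathcal{HE}^2(V,Z)\to\mathrm{Extd}(E,Z)$ sending the $\equiv$-class $\overline{\Omega(Z,V)}$ of $\Omega(Z,V)=(\leftharpoonup_j,\rightharpoonup_j,\triangleleft_j,\triangleright_j,\omega_j,\ast_j,\sigma;\ j=0,1,2,3)$ to (the class of) the unified product $Z\,\natural\,V$ is bijective. (2) Put $\mathcal{HC}^2(V,Z):=\mathcal{Z}(Z,V)/\approx$. The map $\mathcal{HC}^2(V,Z)\to\mathrm{Extd}'(E,Z)$ sending the $\approx$-class $\overline{\overline{\Omega(Z,V)}}$ of $\Omega(Z,V)$ to (the class of) the unified product $Z\,\natural\,V$ is bijective.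
   Context: All vector spaces are over an algebraically closed field $k$ of characteristic different from 2 and 3. A Zinbiel algebra is a vector space $Z$ with a bilinear multiplication $\cdot$ satisfying $(x\cdot y)\cdot z=x\cdot(y\cdot z+z\cdot y)$. A bimodule of a Zinbiel algebra $Z$ is a vector space $V$ with bilinear maps $\triangleright:Z\times V\to V$, $\triangleleft:V\times Z\to V$ such that $(x\cdot y)\triangleright v=x\triangleright(y\triangleright v+v\triangleleft y)$, $(v\triangleleft x)\triangleleft y=v\triangleleft(x\cdot y+y\cdot x)$, $(x\triangleright v)\triangleleft y=x\triangleright(v\triangleleft y+y\triangleright v)$. A Zinbiel algebra $Z_0$ acts on a Zinbiel algebra $Z_1$ if there are bilinear maps $\triangleright:Z_0\times Z_1\to Z_1$, $\triangleleft:Z_1\times Z_0\to Z_1$ making $Z_1$ a $Z_0$-bimodule and such that $(x_0\triangleright x_1)\cdot y_1=x_0\triangleright(x_1\cdot y_1+y_1\cdot x_1)$, $(x_1\triangleleft x_0)\cdot y_1=x_1\cdot(x_0\triangleright y_1+y_1\triangleleft x_0)$, $(x_1\cdot y_1)\triangleleft x_0=x_1\cdot(y_1\triangleleft x_0+x_0\triangleright y_1)$. A (strict) Zinbiel 2-algebra (= crossed module of Zinbiel algebras) $(Z_1,Z_0,\varphi)$ is a homomorphism of Zinbiel algebras $\varphi:Z_1\to Z_0$ with an action of $Z_0$ on $Z_1$ such that $\varphi(x_0\triangleright x_1)=x_0\cdot\varphi(x_1)$, $\varphi(x_1\triangleleft x_0)=\varphi(x_1)\cdot x_0$, $\varphi(x_1)\triangleright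 y_1=x_1\cdot y_1=x_1\triangleleft\varphi(y_1)$. Inside a given Zinbiel 2-algebra $(Z_1,Z_0,\varphi)$ the actions are also written $x_0\cdot x_1:=x_0\triangleright x_1$ and $x_1\cdot x_0:=x_1\triangleleft x_0$. A morphism $(Z_1,Z_0,\varphi)\to(Z_1',Z_0',\varphi')$ is a pair $\phi=(\phi_1,\phi_0)$ of Zinbiel algebra homomorphisms $\phi_i:Z_i\to Z_i'$ with $\varphi'\circ\phi_1=\phi_0\circ\varphi$ that preserves the actions: $\phi_1(x_0\triangleright x_1)=\phi_0(x_0)\triangleright\phi_1(x_1)$ and $\phi_1(x_1\triangleleft x_0)=\phi_1(x_1)\triangleleft\phi_0(x_0)$; it is an isomorphism if $\phi_1,\phi_0$ are bijective. $(Z_1',Z_0',\varphi')$ is a subalgebra of $(Z_1,Z_0,\varphi)$ if $Z_i'$ is a subalgebra of $Z_i$, $\varphi|_{Z_1'}=\varphi'$, and the actions of $Z_0'$ on $Z_1'$ are the restrictions of those of $Z_0$ on $Z_1$. A 2-vector space $(V_1,V_0,d)$ is a pair of vector spaces with a linear map $d:V_1\to V_0$. Let $\pi_i:E_i=Z_i\oplus V_i\to V_i$ be the projection. An extending structure of $(Z_1,Z_0,\varphi)$ through $(V_1,V_0,d)$ on $(E_1,E_0)$ is a Zinbiel 2-algebra structure $(E_1,E_0,\varphi_E)$ on the spaces $E_1,E_0$ (the structure map $\varphi_E$ being part of the structure) that contains $(Z_1,Z_0,\varphi)$ as a subalgebra and satisfies $\pi_0\circ\varphi_E=d\circ\pi_1$.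 A pair of linear maps $\phi=(\phi_1,\phi_0)$, $\phi_i:E_i\to E_i$, stabilizes $(Z_1,Z_0,\varphi)$ if $\phi_i|_{Z_i}=\mathrm{id}_{Z_i}$, and co-stabilizes $(V_1,V_0,d)$ if $\pi_i\circ\phi_i=\pi_i$ ($i=0,1$). Two such structures are equivalent ($\equiv$) if there is an isomorphism of Zinbiel 2-algebras between them which stabilizes $(Z_1,Z_0,\varphi)$, and cohomologous ($\approx$) if there is one which stabilizes $(Z_1,Z_0,\varphi)$ and co-stabilizes $(V_1,V_0,d)$. $\mathrm{Extd}(E,Z)$ and $\mathrm{Extd}'(E,Z)$ denote the sets of $\equiv$-classes and of $\approx$-classes of such structures, respectively. An extending datum of $(Z_1,Z_0,\varphi)$ by $(V_1,V_0,d)$ is a system $\Omega(Z,V)=(\leftharpoonup_j,\rightharpoonup_j,\triangleleft_j,\triangleright_j,\omega_j,\ast_j,\sigma;\ j=0,1,2,3)$ consisting of a linear map $\sigma:V_1\to Z_0$ and twenty-four bilinear maps, as follows. Put $(a,b,c)=(0,0,0)$ for $j=0$, $(1,1,1)$ for $j=1$, $(0,1,1)$ for $j=2$, $(1,0,1)$ for $j=3$; then $\rightharpoonup_j:V_a\times Z_b\to Z_c$, $\leftharpoonup_j:Z_a\times V_b\to Z_c$, $\triangleright_j:Z_a\times V_b\to V_c$, $\triangleleft_j:V_a\times Z_b\to V_c$, $\omega_j:V_a\times V_b\to Z_c$, $\ast_j:V_a\times V_b\to V_c$. The unified product $Z\,\natural\,V$ has underlying spaces $Z_i\oplus V_i=E_i$,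 structure map $(x,u)\mapsto(\varphi(x)+\sigma(u),d(u))$ for $x\in Z_1,u\in V_1$, multiplications (for $i=0,1$) $(x_i,u_i)\circ_i(y_i,v_i)=(x_i\cdot y_i+x_i\leftharpoonup_i v_i+u_i\rightharpoonup_i y_i+\omega_i(u_i,v_i),\ x_i\triangleright_i v_i+u_i\triangleleft_i y_i+u_i\ast_i v_i)$, and actions $(x_0,u_0)\triangleright(x_1,u_1)=(x_0\cdot x_1+x_0\leftharpoonup_2 u_1+u_0\rightharpoonup_2 x_1+\omega_2(u_0,u_1),\ x_0\triangleright_2 u_1+u_0\triangleleft_2 x_1+u_0\ast_2 u_1)$, $(x_1,u_1)\triangleleft(x_0,u_0)=(x_1\cdot x_0+x_1\leftharpoonup_3 u_0+u_1\rightharpoonup_3 x_0+\omega_3(u_1,u_0),\ x_1\triangleright_3 u_0+u_1\triangleleft_3 x_0+u_1\ast_3 u_0)$. $\mathcal{Z}(Z,V)$ denotes the set of extending data $\Omega(Z,V)$ for which $Z\,\natural\,V$ with these operations is a Zinbiel 2-algebra. For $\Omega(Z,V),\Omega'(Z,V)\in\mathcal{Z}(Z,V)$ one writes $\Omega(Z,V)\equiv\Omega'(Z,V)$ if there is an isomorphism of Zinbiel 2-algebras between the associated unified products which stabilizes $(Z_1,Z_0,\varphi)$, and $\Omega(Z,V)\approx\Omega'(Z,V)$ if there is an isomorphism of Zinbiel 2-algebras between the associated unified products which stabilizes $(Z_1,Z_0,\varphi)$ and co-stabilizes $(V_1,V_0,d)$; these are equivalence relations. *)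

theory Defs
  imports Main "HOL-Library.FuncSet" "HOL-Computational_Algebra.Polynomial"
begin

(* Vector spaces are subspaces (carrier sets) of an ambient vector space given by a scalar
   multiplication s. Operations are functions on the ambient types; only their values on the
   carriers are constrained. *)

definition linear_map_on ::
  "('k \<Rightarrow> 'a::ab_group_add \<Rightarrow> 'a) \<Rightarrow> ('k \<Rightarrow> 'b::ab_group_add \<Rightarrow> 'b) \<Rightarrow> 'a set \<Rightarrow> 'b set \<Rightarrow> ('a \<Rightarrow> 'b) \<Rightarrow> bool"
where
  "linear_map_on sA sB A B f \<longleftrightarrow>
     f \<in> A \<rightarrow> B \<and>
     (\<forall>x\<in>A. \<forall>y\<in>A. f (x + y) = f x + f y) \<and>
     (\<forall>c. \<forall>x\<in>A. f (sA c x) = sB c (f x))"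

definition bilinear_map_on ::
  "('k \<Rightarrow> 'a::ab_group_add \<Rightarrow> 'a) \<Rightarrow> ('k \<Rightarrow> 'b::ab_group_add \<Rightarrow> 'b) \<Rightarrow> ('k \<Rightarrow> 'c::ab_group_add \<Rightarrow> 'c) \<Rightarrow>
   'a set \<Rightarrow> 'b set \<Rightarrow> 'c set \<Rightarrow> ('a \<Rightarrow> 'b \<Rightarrow> 'c) \<Rightarrow> bool"
where
  "bilinear_map_on sA sB sC A B C f \<longleftrightarrow>
     (\<forall>x\<in>A. linear_map_on sB sC B C (\<lambda>y. f x y)) \<and>
     (\<forall>y\<in>B. linear_map_on sA sC A C (\<lambda>x. f x y))"

definition zinbiel_algebra ::
  "('k::field \<Rightarrow> 'a::ab_group_add \<Rightarrow> 'a) \<Rightarrow> 'a set \<Rightarrow> ('a \<Rightarrow> 'a \<Rightarrow> 'a) \<Rightarrow> bool"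
where
  "zinbiel_algebra s Z m \<longleftrightarrow>
     vector_space s \<and> module.subspace s Z \<and> bilinear_map_on s s s Z Z Z m \<and>
     (\<forall>x\<in>Z. \<forall>y\<in>Z. \<forall>z\<in>Z. m (m x y) z = m x (m y z + m z y))"

definition zinbiel_hom ::
  "('k \<Rightarrow> 'a::ab_group_add \<Rightarrow> 'a) \<Rightarrow> ('k \<Rightarrow> 'b::ab_group_add \<Rightarrow> 'b) \<Rightarrow> 'a set \<Rightarrow> ('a \<Rightarrow> 'a \<Rightarrow> 'a) \<Rightarrow>
   'b set \<Rightarrow> ('b \<Rightarrow> 'b \<Rightarrow> 'b) \<Rightarrow> ('a \<Rightarrow> 'b) \<Rightarrow> bool"
where
  "zinbiel_hom sA sB A mA B mB f \<longleftrightarrow>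
     linear_map_on sA sB A B f \<and> (\<forall>x\<in>A. \<forall>y\<in>A. f (mA x y) = mB (f x) (f y))"

(* l is the left and r the right operation of Z on V. *)
definition zinbiel_bimodule ::
  "('k::field \<Rightarrow> 'a::ab_group_add \<Rightarrow> 'a) \<Rightarrow> ('k \<Rightarrow> 'b::ab_group_add \<Rightarrow> 'b) \<Rightarrow> 'a set \<Rightarrow> ('a \<Rightarrow> 'a \<Rightarrow> 'a) \<Rightarrow>
   'b set \<Rightarrow> ('a \<Rightarrow> 'b \<Rightarrow> 'b) \<Rightarrow> ('b \<Rightarrow> 'a \<Rightarrow> 'b) \<Rightarrow> bool"
where
  "zinbiel_bimodule sZ sV Z m V l r \<longleftrightarrow>
     zinbiel_algebra sZ Z m \<and> vector_space sV \<and> module.subspace sV V \<and>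
     bilinear_map_on sZ sV sV Z V V l \<and> bilinear_map_on sV sZ sV V Z V r \<and>
     (\<forall>x\<in>Z. \<forall>y\<in>Z. \<forall>v\<in>V.
        l (m x y) v = l x (l y v + r v y) \<and>
        r (r v x) y = r v (m x y + m y x) \<and>
        r (l x v) y = l x (r v y + l y v))"

definition zinbiel_action ::
  "('k::field \<Rightarrow> 'a::ab_group_add \<Rightarrow> 'a) \<Rightarrow> ('k \<Rightarrow> 'b::ab_group_add \<Rightarrow> 'b) \<Rightarrow> 'a set \<Rightarrow> ('a \<Rightarrow> 'a \<Rightarrow> 'a) \<Rightarrow>
   'b set \<Rightarrow> ('b \<Rightarrow> 'b \<Rightarrow> 'b) \<Rightarrow> ('a \<Rightarrow> 'b \<Rightarrow> 'b) \<Rightarrow> ('b \<Rightarrow> 'a \<Rightarrow> 'b) \<Rightarrow> bool"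
where
  "zinbiel_action s0 s1 Z0 m0 Z1 m1 l r \<longleftrightarrow>
     zinbiel_algebra s0 Z0 m0 \<and> zinbiel_algebra s1 Z1 m1 \<and>
     zinbiel_bimodule s0 s1 Z0 m0 Z1 l r \<and>
     (\<forall>x0\<in>Z0. \<forall>x1\<in>Z1. \<forall>y1\<in>Z1.
        m1 (l x0 x1) y1 = l x0 (m1 x1 y1 + m1 y1 x1) \<and>
        m1 (r x1 x0) y1 = m1 x1 (l x0 y1 + r y1 x0) \<and>
        r (m1 x1 y1) x0 = m1 x1 (r y1 x0 + l x0 y1))"

record ('a, 'b) two_alg =
  car1 :: "'a set"
  car0 :: "'b set"
  mult1 :: "'a \<Rightarrow> 'a \<Rightarrow> 'a"
  mult0 :: "'b \<Rightarrow> 'b \<Rightarrow> 'b"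
  lact :: "'b \<Rightarrow> 'a \<Rightarrow> 'a"
  ract :: "'a \<Rightarrow> 'b \<Rightarrow> 'a"
  bdry :: "'a \<Rightarrow> 'b"

definition zinbiel_2_algebra ::
  "('k::field \<Rightarrow> 'a::ab_group_add \<Rightarrow> 'a) \<Rightarrow> ('k \<Rightarrow> 'b::ab_group_add \<Rightarrow> 'b) \<Rightarrow> ('a, 'b) two_alg \<Rightarrow> bool"
where
  "zinbiel_2_algebra s1 s0 S \<longleftrightarrow>
     zinbiel_algebra s1 (car1 S) (mult1 S) \<and> zinbiel_algebra s0 (car0 S) (mult0 S) \<and>
     zinbiel_hom s1 s0 (car1 S) (mult1 S) (car0 S) (mult0 S) (bdry S) \<and>
     zinbiel_action s0 s1 (car0 S) (mult0 S) (car1 S) (mult1 S) (lact S) (ract S) \<and>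
     (\<forall>x0\<in>car0 S. \<forall>x1\<in>car1 S.
        bdry S (lact S x0 x1) = mult0 S x0 (bdry S x1) \<and>
        bdry S (ract S x1 x0) = mult0 S (bdry S x1) x0) \<and>
     (\<forall>x1\<in>car1 S. \<forall>y1\<in>car1 S.
        lact S (bdry S x1) y1 = mult1 S x1 y1 \<and>
        mult1 S x1 y1 = ract S x1 (bdry S y1))"

definition two_alg_morphism ::
  "('k \<Rightarrow> 'a::ab_group_add \<Rightarrow> 'a) \<Rightarrow> ('k \<Rightarrow> 'b::ab_group_add \<Rightarrow> 'b) \<Rightarrow>
   ('k \<Rightarrow> 'c::ab_group_add \<Rightarrow> 'c) \<Rightarrow> ('k \<Rightarrow> 'd::ab_group_add \<Rightarrow> 'd) \<Rightarrow>
   ('a, 'b) two_alg \<Rightarrow> ('c, 'd) two_alg \<Rightarrow> ('a \<Rightarrow> 'c) \<Rightarrow> ('b \<Rightarrow> 'd) \<Rightarrow> bool"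
where
  "two_alg_morphism s1 s0 s1' s0' S S' f1 f0 \<longleftrightarrow>
     zinbiel_hom s1 s1' (car1 S) (mult1 S) (car1 S') (mult1 S') f1 \<and>
     zinbiel_hom s0 s0' (car0 S) (mult0 S) (car0 S') (mult0 S') f0 \<and>
     (\<forall>x1\<in>car1 S. bdry S' (f1 x1) = f0 (bdry S x1)) \<and>
     (\<forall>x0\<in>car0 S. \<forall>x1\<in>car1 S.
        f1 (lact S x0 x1) = lact S' (f0 x0) (f1 x1) \<and>
        f1 (ract S x1 x0) = ract S' (f1 x1) (f0 x0))"

definition two_alg_iso ::
  "('k \<Rightarrow> 'a::ab_group_add \<Rightarrow> 'a) \<Rightarrow> ('k \<Rightarrow> 'b::ab_group_add \<Rightarrow> 'b) \<Rightarrow>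
   ('k \<Rightarrow> 'c::ab_group_add \<Rightarrow> 'c) \<Rightarrow> ('k \<Rightarrow> 'd::ab_group_add \<Rightarrow> 'd) \<Rightarrow>
   ('a, 'b) two_alg \<Rightarrow> ('c, 'd) two_alg \<Rightarrow> ('a \<Rightarrow> 'c) \<Rightarrow> ('b \<Rightarrow> 'd) \<Rightarrow> bool"
where
  "two_alg_iso s1 s0 s1' s0' S S' f1 f0 \<longleftrightarrow>
     two_alg_morphism s1 s0 s1' s0' S S' f1 f0 \<and>
     bij_betw f1 (car1 S) (car1 S') \<and> bij_betw f0 (car0 S) (car0 S')"

definition two_subalgebra ::
  "('k::field \<Rightarrow> 'a::ab_group_add \<Rightarrow> 'a) \<Rightarrow> ('k \<Rightarrow> 'b::ab_group_add \<Rightarrow> 'b) \<Rightarrow>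
   ('a, 'b) two_alg \<Rightarrow> ('a, 'b) two_alg \<Rightarrow> bool"
where
  "two_subalgebra s1 s0 T S \<longleftrightarrow>
     zinbiel_2_algebra s1 s0 T \<and> zinbiel_2_algebra s1 s0 S \<and>
     car1 T \<subseteq> car1 S \<and> car0 T \<subseteq> car0 S \<and>
     (\<forall>x\<in>car1 T. \<forall>y\<in>car1 T. mult1 S x y = mult1 T x y) \<and>
     (\<forall>x\<in>car0 T. \<forall>y\<in>car0 T. mult0 S x y = mult0 T x y) \<and>
     (\<forall>x\<in>car1 T. bdry S x = bdry T x) \<and>
     (\<forall>x0\<in>car0 T. \<forall>x1\<in>car1 T.
        lact S x0 x1 = lact T x0 x1 \<and> ract S x1 x0 = ract T x1 x0)"

definition two_vector_space ::
  "('k::field \<Rightarrow> 'a::ab_group_add \<Rightarrow> 'a) \<Rightarrow> ('k \<Rightarrow> 'b::ab_group_add \<Rightarrow> 'b) \<Rightarrow>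
   'a set \<Rightarrow> 'b set \<Rightarrow> ('a \<Rightarrow> 'b) \<Rightarrow> bool"
where
  "two_vector_space s1 s0 V1 V0 d \<longleftrightarrow>
     vector_space s1 \<and> vector_space s0 \<and> module.subspace s1 V1 \<and> module.subspace s0 V0 \<and>
     linear_map_on s1 s0 V1 V0 d"

(* The whole type is the internal direct sum of Z and V. *)
definition complementary ::
  "('k::field \<Rightarrow> 'a::ab_group_add \<Rightarrow> 'a) \<Rightarrow> 'a set \<Rightarrow> 'a set \<Rightarrow> bool"
where
  "complementary s Z V \<longleftrightarrow>
     module.subspace s Z \<and> module.subspace s V \<and> Z \<inter> V = {0} \<and>
     (\<forall>e. \<exists>z\<in>Z. \<exists>v\<in>V. e = z + v)"

(* proj_along V Z is the projection onto V along Z; meaningful if Z and V are complementary. *)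
definition proj_along :: "'a::ab_group_add set \<Rightarrow> 'a set \<Rightarrow> 'a \<Rightarrow> 'a" where
  "proj_along V Z e = (THE v. v \<in> V \<and> e - v \<in> Z)"

(* The structures on (E1, E0), where E1 and E0 are the full types. *)
definition extending_structures ::
  "('k::field \<Rightarrow> 'a::ab_group_add \<Rightarrow> 'a) \<Rightarrow> ('k \<Rightarrow> 'b::ab_group_add \<Rightarrow> 'b) \<Rightarrow> ('a, 'b) two_alg \<Rightarrow>
   'a set \<Rightarrow> 'b set \<Rightarrow> ('a \<Rightarrow> 'b) \<Rightarrow> ('a, 'b) two_alg set"
where
  "extending_structures s1 s0 Z V1 V0 d =
     {S. zinbiel_2_algebra s1 s0 S \<and> car1 S = UNIV \<and> car0 S = UNIV \<and>
         two_subalgebra s1 s0 Z S \<and>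
         (\<forall>e. proj_along V0 (car0 Z) (bdry S e) = d (proj_along V1 (car1 Z) e))}"

definition stabilizes :: "('a, 'b) two_alg \<Rightarrow> ('a \<Rightarrow> 'a) \<Rightarrow> ('b \<Rightarrow> 'b) \<Rightarrow> bool" where
  "stabilizes Z f1 f0 \<longleftrightarrow> (\<forall>x\<in>car1 Z. f1 x = x) \<and> (\<forall>x\<in>car0 Z. f0 x = x)"

definition costabilizes ::
  "('a::ab_group_add, 'b::ab_group_add) two_alg \<Rightarrow> 'a set \<Rightarrow> 'b set \<Rightarrow> ('a \<Rightarrow> 'a) \<Rightarrow> ('b \<Rightarrow> 'b) \<Rightarrow> bool"
where
  "costabilizes Z V1 V0 f1 f0 \<longleftrightarrow>
     (\<forall>e. proj_along V1 (car1 Z) (f1 e) = proj_along V1 (car1 Z) e) \<and>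
     (\<forall>e. proj_along V0 (car0 Z) (f0 e) = proj_along V0 (car0 Z) e)"

definition equivalent_structures ::
  "('k \<Rightarrow> 'a::ab_group_add \<Rightarrow> 'a) \<Rightarrow> ('k \<Rightarrow> 'b::ab_group_add \<Rightarrow> 'b) \<Rightarrow> ('a, 'b) two_alg \<Rightarrow>
   ('a, 'b) two_alg \<Rightarrow> ('a, 'b) two_alg \<Rightarrow> bool"
where
  "equivalent_structures s1 s0 Z S S' \<longleftrightarrow>
     (\<exists>f1 f0. two_alg_iso s1 s0 s1 s0 S S' f1 f0 \<and> stabilizes Z f1 f0)"

definition cohomologous_structures ::
  "('k \<Rightarrow> 'a::ab_group_add \<Rightarrow> 'a) \<Rightarrow> ('k \<Rightarrow> 'b::ab_group_add \<Rightarrow> 'b) \<Rightarrow> ('a, 'b) two_alg \<Rightarrow>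
   'a set \<Rightarrow> 'b set \<Rightarrow> ('a, 'b) two_alg \<Rightarrow> ('a, 'b) two_alg \<Rightarrow> bool"
where
  "cohomologous_structures s1 s0 Z V1 V0 S S' \<longleftrightarrow>
     (\<exists>f1 f0. two_alg_iso s1 s0 s1 s0 S S' f1 f0 \<and> stabilizes Z f1 f0 \<and> costabilizes Z V1 V0 f1 f0)"

definition equiv_rel ::
  "('k::field \<Rightarrow> 'a::ab_group_add \<Rightarrow> 'a) \<Rightarrow> ('k \<Rightarrow> 'b::ab_group_add \<Rightarrow> 'b) \<Rightarrow> ('a, 'b) two_alg \<Rightarrow>
   'a set \<Rightarrow> 'b set \<Rightarrow> ('a \<Rightarrow> 'b) \<Rightarrow> (('a, 'b) two_alg \<times> ('a, 'b) two_alg) set"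
where
  "equiv_rel s1 s0 Z V1 V0 d =
     {(S, S'). S \<in> extending_structures s1 s0 Z V1 V0 d \<and> S' \<in> extending_structures s1 s0 Z V1 V0 d \<and>
               equivalent_structures s1 s0 Z S S'}"

definition cohom_rel ::
  "('k::field \<Rightarrow> 'a::ab_group_add \<Rightarrow> 'a) \<Rightarrow> ('k \<Rightarrow> 'b::ab_group_add \<Rightarrow> 'b) \<Rightarrow> ('a, 'b) two_alg \<Rightarrow>
   'a set \<Rightarrow> 'b set \<Rightarrow> ('a \<Rightarrow> 'b) \<Rightarrow> (('a, 'b) two_alg \<times> ('a, 'b) two_alg) set"
where
  "cohom_rel s1 s0 Z V1 V0 d =
     {(S, S'). S \<in> extending_structures s1 s0 Z V1 V0 d \<and> S' \<in> extending_structures s1 s0 Z V1 V0 d \<and>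
               cohomologous_structures s1 s0 Z V1 V0 S S'}"

definition Extd where
  "Extd s1 s0 Z V1 V0 d = extending_structures s1 s0 Z V1 V0 d // equiv_rel s1 s0 Z V1 V0 d"

definition Extd' where
  "Extd' s1 s0 Z V1 V0 d = extending_structures s1 s0 Z V1 V0 d // cohom_rel s1 s0 Z V1 V0 d"

(* The six maps carrying one index j; 'a, 'b, 'c are the types of the ambient spaces
   E_a, E_b, E_c.  In the order of the fields:
   rharp : V_a x Z_b -> Z_c,   lharp : Z_a x V_b -> Z_c,
   rtri  : Z_a x V_b -> V_c,   ltri  : V_a x Z_b -> V_c,
   omega : V_a x V_b -> Z_c,   ast   : V_a x V_b -> V_c. *)
record ('a, 'b, 'c) datum_part =
  rharp :: "'a \<Rightarrow> 'b \<Rightarrow> 'c"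
  lharp :: "'a \<Rightarrow> 'b \<Rightarrow> 'c"
  rtri :: "'a \<Rightarrow> 'b \<Rightarrow> 'c"
  ltri :: "'a \<Rightarrow> 'b \<Rightarrow> 'c"
  omega :: "'a \<Rightarrow> 'b \<Rightarrow> 'c"
  ast :: "'a \<Rightarrow> 'b \<Rightarrow> 'c"

record ('a, 'b) ext_datum =
  part0 :: "('b, 'b, 'b) datum_part"
  part1 :: "('a, 'a, 'a) datum_part"
  part2 :: "('b, 'a, 'a) datum_part"
  part3 :: "('a, 'b, 'a) datum_part"
  sigma :: "'a \<Rightarrow> 'b"

(* Bilinear maps A x B -> C, made extensional so that equality of such functions is equality
   of maps on A x B. *)
definition bilinear_maps ::
  "('k \<Rightarrow> 'a::ab_group_add \<Rightarrow> 'a) \<Rightarrow> ('k \<Rightarrow> 'b::ab_group_add \<Rightarrow> 'b) \<Rightarrow> ('k \<Rightarrow> 'c::ab_group_add \<Rightarrow> 'c) \<Rightarrow>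
   'a set \<Rightarrow> 'b set \<Rightarrow> 'c set \<Rightarrow> ('a \<Rightarrow> 'b \<Rightarrow> 'c) set"
where
  "bilinear_maps sA sB sC A B C =
     {f \<in> A \<rightarrow>\<^sub>E (B \<rightarrow>\<^sub>E C). bilinear_map_on sA sB sC A B C f}"

definition is_datum_part ::
  "('k \<Rightarrow> 'a::ab_group_add \<Rightarrow> 'a) \<Rightarrow> ('k \<Rightarrow> 'b::ab_group_add \<Rightarrow> 'b) \<Rightarrow> ('k \<Rightarrow> 'c::ab_group_add \<Rightarrow> 'c) \<Rightarrow>
   'a set \<Rightarrow> 'a set \<Rightarrow> 'b set \<Rightarrow> 'b set \<Rightarrow> 'c set \<Rightarrow> 'c set \<Rightarrow> ('a, 'b, 'c) datum_part \<Rightarrow> bool"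
where
  "is_datum_part sa sb sc Za Va Zb Vb Zc Vc D \<longleftrightarrow>
     rharp D \<in> bilinear_maps sa sb sc Va Zb Zc \<and>
     lharp D \<in> bilinear_maps sa sb sc Za Vb Zc \<and>
     rtri D \<in> bilinear_maps sa sb sc Za Vb Vc \<and>
     ltri D \<in> bilinear_maps sa sb sc Va Zb Vc \<and>
     omega D \<in> bilinear_maps sa sb sc Va Vb Zc \<and>
     ast D \<in> bilinear_maps sa sb sc Va Vb Vc"

definition extending_datum ::
  "('k \<Rightarrow> 'a::ab_group_add \<Rightarrow> 'a) \<Rightarrow> ('k \<Rightarrow> 'b::ab_group_add \<Rightarrow> 'b) \<Rightarrow> ('a, 'b) two_alg \<Rightarrow>
   'a set \<Rightarrow> 'b set \<Rightarrow> ('a, 'b) ext_datum \<Rightarrow> bool"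
where
  "extending_datum s1 s0 Z V1 V0 D \<longleftrightarrow>
     is_datum_part s0 s0 s0 (car0 Z) V0 (car0 Z) V0 (car0 Z) V0 (part0 D) \<and>
     is_datum_part s1 s1 s1 (car1 Z) V1 (car1 Z) V1 (car1 Z) V1 (part1 D) \<and>
     is_datum_part s0 s1 s1 (car0 Z) V0 (car1 Z) V1 (car1 Z) V1 (part2 D) \<and>
     is_datum_part s1 s0 s1 (car1 Z) V1 (car0 Z) V0 (car1 Z) V1 (part3 D) \<and>
     sigma D \<in> V1 \<rightarrow>\<^sub>E car0 Z \<and> linear_map_on s1 s0 V1 (car0 Z) (sigma D)"

(* The common shape of the multiplications and actions of the unified product: the value at
   (x, u), (y, v) is the sum of its Z_c-part and its V_c-part. *)
definition unified_op ::
  "('a \<Rightarrow> 'b \<Rightarrow> 'c::ab_group_add) \<Rightarrow> ('a, 'b, 'c) datum_part \<Rightarrow> 'a \<Rightarrow> 'a \<Rightarrow> 'b \<Rightarrow> 'b \<Rightarrow> 'c"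
where
  "unified_op m D x u y v =
     (m x y + lharp D x v + rharp D u y + omega D u v) +
     (rtri D x v + ltri D u y + ast D u v)"

(* The pair (x, u) of Z_i + V_i is the element x + u of E_i, with x and u recovered by the
   projections. *)
definition unified_product ::
  "('a::ab_group_add, 'b::ab_group_add) two_alg \<Rightarrow> 'a set \<Rightarrow> 'b set \<Rightarrow> ('a \<Rightarrow> 'b) \<Rightarrow>
   ('a, 'b) ext_datum \<Rightarrow> ('a, 'b) two_alg"
where
  "unified_product Z V1 V0 d D =
     (let z1 = proj_along (car1 Z) V1; v1 = proj_along V1 (car1 Z);
          z0 = proj_along (car0 Z) V0; v0 = proj_along V0 (car0 Z)
      in \<lparr>car1 = UNIV, car0 = UNIV,
          mult1 = (\<lambda>e f. unified_op (mult1 Z) (part1 D) (z1 e) (v1 e) (z1 f) (v1 f)),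
          mult0 = (\<lambda>e f. unified_op (mult0 Z) (part0 D) (z0 e) (v0 e) (z0 f) (v0 f)),
          lact = (\<lambda>e f. unified_op (lact Z) (part2 D) (z0 e) (v0 e) (z1 f) (v1 f)),
          ract = (\<lambda>e f. unified_op (ract Z) (part3 D) (z1 e) (v1 e) (z0 f) (v0 f)),
          bdry = (\<lambda>e. (bdry Z (z1 e) + sigma D (v1 e)) + d (v1 e))\<rparr>)"

definition ZZ ::
  "('k::field \<Rightarrow> 'a::ab_group_add \<Rightarrow> 'a) \<Rightarrow> ('k \<Rightarrow> 'b::ab_group_add \<Rightarrow> 'b) \<Rightarrow> ('a, 'b) two_alg \<Rightarrow>
   'a set \<Rightarrow> 'b set \<Rightarrow> ('a \<Rightarrow> 'b) \<Rightarrow> ('a, 'b) ext_datum set"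
where
  "ZZ s1 s0 Z V1 V0 d =
     {D. extending_datum s1 s0 Z V1 V0 D \<and> zinbiel_2_algebra s1 s0 (unified_product Z V1 V0 d D)}"

definition datum_equiv_rel ::
  "('k::field \<Rightarrow> 'a::ab_group_add \<Rightarrow> 'a) \<Rightarrow> ('k \<Rightarrow> 'b::ab_group_add \<Rightarrow> 'b) \<Rightarrow> ('a, 'b) two_alg \<Rightarrow>
   'a set \<Rightarrow> 'b set \<Rightarrow> ('a \<Rightarrow> 'b) \<Rightarrow> (('a, 'b) ext_datum \<times> ('a, 'b) ext_datum) set"
where
  "datum_equiv_rel s1 s0 Z V1 V0 d =
     {(D, D'). D \<in> ZZ s1 s0 Z V1 V0 d \<and> D' \<in> ZZ s1 s0 Z V1 V0 d \<and>
               equivalent_structures s1 s0 Z (unified_product Z V1 V0 d D) (unified_product Z V1 V0 d D')}"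

definition datum_cohom_rel ::
  "('k::field \<Rightarrow> 'a::ab_group_add \<Rightarrow> 'a) \<Rightarrow> ('k \<Rightarrow> 'b::ab_group_add \<Rightarrow> 'b) \<Rightarrow> ('a, 'b) two_alg \<Rightarrow>
   'a set \<Rightarrow> 'b set \<Rightarrow> ('a \<Rightarrow> 'b) \<Rightarrow> (('a, 'b) ext_datum \<times> ('a, 'b) ext_datum) set"
where
  "datum_cohom_rel s1 s0 Z V1 V0 d =
     {(D, D'). D \<in> ZZ s1 s0 Z V1 V0 d \<and> D' \<in> ZZ s1 s0 Z V1 V0 d \<and>
               cohomologous_structures s1 s0 Z V1 V0 (unified_product Z V1 V0 d D) (unified_product Z V1 V0 d D')}"

definition HE2 where
  "HE2 s1 s0 Z V1 V0 d = ZZ s1 s0 Z V1 V0 d // datum_equiv_rel s1 s0 Z V1 V0 d"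

definition HC2 where
  "HC2 s1 s0 Z V1 V0 d = ZZ s1 s0 Z V1 V0 d // datum_cohom_rel s1 s0 Z V1 V0 d"

end

theory Submission
  imports Defs
begin

text \<open>
  A structure on \<open>E\<close> extending \<open>Z\<close> is not merely isomorphic but equal to a unified product: the
  datum is read off by restricting each operation to the summands \<open>Z\<close> and \<open>V\<close> and composing with
  the two projections, and bilinearity gives the operation back. Hence \<open>D \<mapsto> Z \<natural> V\<close> is a
  surjection from the data onto the extending structures, and the two relations on data are the
  preimages under it of the two relations on structures.
\<close>

section \<open>Quotients by a pulled-back equivalence relation\<close>

text \<open>Since \<open>R'\<close> is the preimage of \<open>R\<close> under \<open>g\<close>, the
  map induced on classes is both well defined and injective; it is onto because \<open>g\<close> is.
  Both halves of the theorem are instances, with \<open>g\<close> the unified product.\<close>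

lemma quotient_bij_betw_pullback:
  assumes "equiv B R" and surj: "g ` A = B"
    and R': "R' = {(a, a'). a \<in> A \<and> a' \<in> A \<and> (g a, g a') \<in> R}"
  shows "\<exists>F. (\<forall>a\<in>A. F (R' `` {a}) = R `` {g a}) \<and> bij_betw F (A // R') (B // R)"
proof -
  define F where "F X = R `` (g ` X)" for X
  have refl: "(g a, g a) \<in> R" if "a \<in> A" for a
    using assms(1) surj that by (auto simp: equiv_def refl_on_def)
  have F: "F (R' `` {a}) = R `` {g a}" if "a \<in> A" for a
  proof
    show "F (R' `` {a}) \<subseteq> R `` {g a}"
      using assms(1) by (auto simp: F_def R' equiv_def dest: transD)
    show "R `` {g a} \<subseteq> F (R' `` {a})"
      using refl[OF that] that by (auto simp: F_def R')
  qed
  have "inj_on F (A // R')"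
  proof (rule inj_onI)
    fix X Y assume "X \<in> A // R'" "Y \<in> A // R'" "F X = F Y"
    then obtain a b where ab: "a \<in> A" "b \<in> A" "X = R' `` {a}" "Y = R' `` {b}"
      and "R `` {g a} = R `` {g b}"
      by (auto simp: quotient_def F)
    then have "(g a, g b) \<in> R"
      using eq_equiv_class[OF _ assms(1)] surj by blast
    then have "R `` {g a} = R `` {g b}" "(g b, g a) \<in> R"
      using assms(1) by (auto simp: equiv_class_eq_iff equiv_def dest: symD transD)
    \<comment> \<open>An element \<open>c\<close> of \<open>A\<close> lies in the
      \<open>R'\<close>-class of \<open>a\<close> precisely when \<open>(g a, g c)\<close> is in
      \<open>R\<close>, so this identifies the two classes.\<close>
    then have "(g a, g c) \<in> R \<longleftrightarrow> (g b, g c) \<in> R" for c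
      by blast
    then show "X = Y"
      using ab by (auto simp: R')
  qed
  moreover have "F ` (A // R') = B // R"
    unfolding quotient_def surj[symmetric] by (auto simp: F image_iff)
  ultimately show ?thesis
    using F unfolding bij_betw_def by blast
qed

section \<open>Linear and bilinear maps between carriers\<close>

lemma linear_map_on_zero:
  assumes "linear_map_on sA sB A B f" "0 \<in> A"
  shows "f 0 = 0"
proof -
  have "f (0 + 0) = f 0 + f 0"
    using assms unfolding linear_map_on_def by blast
  then show ?thesis by simp
qed

lemma bilinear_map_on_zero:
  assumes "bilinear_map_on sA sB sC A B C f"
  shows "x \<in> A \<Longrightarrow> 0 \<in> B \<Longrightarrow> f x 0 = 0" "y \<in> B \<Longrightarrow> 0 \<in> A \<Longrightarrow> f 0 y = 0"
  using assms linear_map_on_zero[of sB sC B C "f x"] linear_map_on_zero[of sA sC A C "\<lambda>x. f x y"]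
  unfolding bilinear_map_on_def by auto

lemma bilinear_map_on_add:
  assumes "bilinear_map_on sA sB sC UNIV UNIV UNIV f"
  shows "f (x + u) (y + v) = f x y + f x v + f u y + f u v"
proof -
  have "f (x + u) (y + v) = f x (y + v) + f u (y + v)"
    "f x (y + v) = f x y + f x v" "f u (y + v) = f u y + f u v"
    using assms unfolding bilinear_map_on_def linear_map_on_def by blast+
  then show ?thesis by (simp add: add.assoc)
qed

lemma subspace_closed:
  assumes "vector_space s" "module.subspace s A"
  shows "0 \<in> A" "x \<in> A \<Longrightarrow> y \<in> A \<Longrightarrow> x + y \<in> A" "x \<in> A \<Longrightarrow> s c x \<in> A"
    "x \<in> A \<Longrightarrow> y \<in> A \<Longrightarrow> x - y \<in> A"
proof -
  interpret vector_space s by fact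
  show "0 \<in> A" "x \<in> A \<Longrightarrow> y \<in> A \<Longrightarrow> x + y \<in> A" "x \<in> A \<Longrightarrow> s c x \<in> A"
    "x \<in> A \<Longrightarrow> y \<in> A \<Longrightarrow> x - y \<in> A"
    using assms(2) subspace_0 subspace_add subspace_scale subspace_diff by auto
qed

lemma linear_map_on_inv_into:
  assumes lin: "linear_map_on sA sB A B f" and bij: "bij_betw f A B"
    and A: "vector_space sA" "module.subspace sA A"
  shows "linear_map_on sB sA B A (inv_into A f)"
  unfolding linear_map_on_def
proof (intro conjI ballI allI)
  let ?g = "inv_into A f"
  have gB: "?g b \<in> A" "f (?g b) = b" if "b \<in> B" for b
    using that bij by (auto simp: bij_betw_def inv_into_into f_inv_into_f)
  have gf: "?g (f a) = a" if "a \<in> A" for a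
    using that bij by (auto simp: bij_betw_def)
  show "?g \<in> B \<rightarrow> A"
    using gB by auto
  fix x assume x: "x \<in> B"
  show "?g (x + y) = ?g x + ?g y" if y: "y \<in> B" for y
    using lin gf[of "?g x + ?g y"] gB x y subspace_closed(2)[OF A]
    by (simp add: linear_map_on_def)
  show "?g (sB c x) = sA c (?g x)" for c
    using lin gf[of "sA c (?g x)"] gB x subspace_closed(3)[OF A]
    by (simp add: linear_map_on_def)
qed

lemma linear_map_on_comp:
  "linear_map_on sA sB A B f \<Longrightarrow> linear_map_on sB sC B C g \<Longrightarrow> linear_map_on sA sC A C (g \<circ> f)"
  by (auto simp: linear_map_on_def Pi_iff)

text \<open>Three separate bijections let one statement serve both multiplications and both actions,
  whose arguments and values may lie in different levels. Closure of \<open>m\<close> in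
  \<open>C\<close> is what allows \<open>inv_into C h\<close> to cancel \<open>h\<close>.\<close>

lemma inv_into_mult:
  assumes "bij_betw f A A'" "bij_betw g B B'" "bij_betw h C C'"
    and "\<forall>x\<in>A. \<forall>y\<in>B. m x y \<in> C \<and> h (m x y) = m' (f x) (g y)"
    and "x \<in> A'" "y \<in> B'"
  shows "inv_into C h (m' x y) = m (inv_into A f x) (inv_into B g y)"
proof -
  obtain a b where "a \<in> A" "b \<in> B" "x = f a" "y = g b"
    using assms by (auto simp: bij_betw_def)
  then show ?thesis
    using assms(1-4) by (metis bij_betw_inv_into_left)
qed

lemma bilinear_map_on_closed:
  "bilinear_map_on sA sB sC A B C f \<Longrightarrow> x \<in> A \<Longrightarrow> y \<in> B \<Longrightarrow> f x y \<in> C"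
  by (auto simp: bilinear_map_on_def linear_map_on_def Pi_iff)

section \<open>Isomorphisms of Zinbiel 2-algebras\<close>

lemma zinbiel_2_algebra_bilinear:
  assumes "zinbiel_2_algebra s1 s0 S"
  shows "bilinear_map_on s1 s1 s1 (car1 S) (car1 S) (car1 S) (mult1 S)"
    "bilinear_map_on s0 s0 s0 (car0 S) (car0 S) (car0 S) (mult0 S)"
    "bilinear_map_on s0 s1 s1 (car0 S) (car1 S) (car1 S) (lact S)"
    "bilinear_map_on s1 s0 s1 (car1 S) (car0 S) (car1 S) (ract S)"
  using assms
  by (auto simp: zinbiel_2_algebra_def zinbiel_algebra_def zinbiel_action_def zinbiel_bimodule_def)

lemma zinbiel_2_algebra_bdry:
  "zinbiel_2_algebra s1 s0 S \<Longrightarrow> linear_map_on s1 s0 (car1 S) (car0 S) (bdry S)"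
  by (simp add: zinbiel_2_algebra_def zinbiel_hom_def)

lemma zinbiel_2_algebra_subspace:
  assumes "zinbiel_2_algebra s1 s0 S"
  shows "vector_space s1" "vector_space s0"
    "module.subspace s1 (car1 S)" "module.subspace s0 (car0 S)"
  using assms by (auto simp: zinbiel_2_algebra_def zinbiel_algebra_def)

lemma two_alg_iso_id: "two_alg_iso s1 s0 s1 s0 S S id id" if "zinbiel_2_algebra s1 s0 S"
  using zinbiel_2_algebra_bilinear[OF that]
  by (auto simp: two_alg_iso_def two_alg_morphism_def zinbiel_hom_def linear_map_on_def)

text \<open>Isomorphisms are defined as bijective morphisms, so it has to be checked that the
  inverse preserves the whole structure. This yields symmetry of both relations.\<close>

lemma two_alg_iso_inv_into:
  assumes iso: "two_alg_iso s1 s0 s1' s0' S S' f1 f0" and S: "zinbiel_2_algebra s1 s0 S"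
  shows "two_alg_iso s1' s0' s1 s0 S' S (inv_into (car1 S) f1) (inv_into (car0 S) f0)"
proof -
  have bij: "bij_betw f1 (car1 S) (car1 S')" "bij_betw f0 (car0 S) (car0 S')"
    and lin: "linear_map_on s1 s1' (car1 S) (car1 S') f1" "linear_map_on s0 s0' (car0 S) (car0 S') f0"
    and mor: "two_alg_morphism s1 s0 s1' s0' S S' f1 f0"
    using iso by (auto simp: two_alg_iso_def two_alg_morphism_def zinbiel_hom_def)
  note closed = zinbiel_2_algebra_bilinear[OF S, THEN bilinear_map_on_closed]
  \<comment> \<open>The commuting square for \<open>f1\<close>, \<open>f0\<close> is read backwards
    from a preimage \<open>a\<close> of \<open>x\<close>; \<open>bdry S a\<close> must lie in
    \<open>car0 S\<close> for \<open>inv_into\<close> to cancel \<open>f0\<close>.\<close>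
  have bdry: "bdry S (inv_into (car1 S) f1 x) = inv_into (car0 S) f0 (bdry S' x)"
    if x: "x \<in> car1 S'" for x
  proof -
    obtain a where a: "a \<in> car1 S" "x = f1 a"
      using x bij unfolding bij_betw_def by blast
    then have "bdry S' x = f0 (bdry S a)" "bdry S a \<in> car0 S"
      using mor zinbiel_2_algebra_bdry[OF S]
      by (auto simp: two_alg_morphism_def linear_map_on_def)
    then show ?thesis
      using a bij by (simp add: bij_betw_inv_into_left)
  qed
  have "inv_into (car1 S) f1 (mult1 S' x y) = mult1 S (inv_into (car1 S) f1 x) (inv_into (car1 S) f1 y)"
    if "x \<in> car1 S'" "y \<in> car1 S'" for x y
    using that mor closed
    by (intro inv_into_mult[OF bij(1) bij(1) bij(1), where m = "mult1 S" and m' = "mult1 S'"])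
      (auto simp: two_alg_morphism_def zinbiel_hom_def)
  moreover have "inv_into (car0 S) f0 (mult0 S' x y) = mult0 S (inv_into (car0 S) f0 x) (inv_into (car0 S) f0 y)"
    if "x \<in> car0 S'" "y \<in> car0 S'" for x y
    using that mor closed
    by (intro inv_into_mult[OF bij(2) bij(2) bij(2), where m = "mult0 S" and m' = "mult0 S'"])
      (auto simp: two_alg_morphism_def zinbiel_hom_def)
  moreover have "inv_into (car1 S) f1 (lact S' x y) = lact S (inv_into (car0 S) f0 x) (inv_into (car1 S) f1 y)"
    if "x \<in> car0 S'" "y \<in> car1 S'" for x y
    using that mor closed
    by (intro inv_into_mult[OF bij(2) bij(1) bij(1), where m = "lact S" and m' = "lact S'"])
      (auto simp: two_alg_morphism_def)
  moreover have "inv_into (car1 S) f1 (ract S' x y) = ract S (inv_into (car1 S) f1 x) (inv_into (car0 S) f0 y)"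
    if "x \<in> car1 S'" "y \<in> car0 S'" for x y
    using that mor closed
    by (intro inv_into_mult[OF bij(1) bij(2) bij(1), where m = "ract S" and m' = "ract S'"])
      (auto simp: two_alg_morphism_def)
  ultimately show ?thesis
    using bdry bij[THEN bij_betw_inv_into] zinbiel_2_algebra_subspace[OF S]
      linear_map_on_inv_into[OF lin(1) bij(1)] linear_map_on_inv_into[OF lin(2) bij(2)]
    by (simp add: two_alg_iso_def two_alg_morphism_def zinbiel_hom_def)
qed

lemma two_alg_iso_comp:
  assumes "two_alg_iso s1 s0 s1' s0' S S' f1 f0" "two_alg_iso s1' s0' s1'' s0'' S' S'' g1 g0"
  shows "two_alg_iso s1 s0 s1'' s0'' S S'' (g1 \<circ> f1) (g0 \<circ> f0)"
proof -
  have "f1 x \<in> car1 S'" if "x \<in> car1 S" for x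
    using assms(1) that by (auto simp: two_alg_iso_def bij_betw_def)
  moreover have "f0 x \<in> car0 S'" if "x \<in> car0 S" for x
    using assms(1) that by (auto simp: two_alg_iso_def bij_betw_def)
  ultimately show ?thesis
    using assms
    by (auto simp: two_alg_iso_def two_alg_morphism_def zinbiel_hom_def
        intro: linear_map_on_comp bij_betw_trans)
qed

section \<open>The two relations on extending structures\<close>

lemma extending_structuresD:
  assumes "S \<in> extending_structures s1 s0 Z V1 V0 d"
  shows "zinbiel_2_algebra s1 s0 S" "car1 S = UNIV" "car0 S = UNIV"
  using assms by (auto simp: extending_structures_def)

text \<open>One argument serves for both relations: \<open>P\<close> is either trivial or co-stabilization.\<close>

lemma equiv_stabilizing_iso:
  fixes s1 :: "'k::field \<Rightarrow> 'a::ab_group_add \<Rightarrow> 'a" and s0 :: "'k \<Rightarrow> 'b::ab_group_add \<Rightarrow> 'b"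
    and Z :: "('a, 'b) two_alg" and V1 :: "'a set" and V0 :: "'b set" and d :: "'a \<Rightarrow> 'b"
  assumes id: "P id id"
    and inv: "\<And>f1 f0. bij f1 \<Longrightarrow> bij f0 \<Longrightarrow> P f1 f0 \<Longrightarrow> P (inv f1) (inv f0)"
    and comp: "\<And>f1 f0 g1 g0. P f1 f0 \<Longrightarrow> P g1 g0 \<Longrightarrow> P (g1 \<circ> f1) (g0 \<circ> f0)"
  defines "X \<equiv> extending_structures s1 s0 Z V1 V0 d"
  shows "equiv X {(S, S'). S \<in> X \<and> S' \<in> X \<and>
    (\<exists>f1 f0. two_alg_iso s1 s0 s1 s0 S S' f1 f0 \<and> stabilizes Z f1 f0 \<and> P f1 f0)}"
    (is "equiv X ?R")
proof (rule equivI)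
  note X = extending_structuresD[of _ s1 s0 Z V1 V0 d, folded X_def]
  show "?R \<subseteq> X \<times> X"
    by auto
  show "refl_on X ?R"
    using two_alg_iso_id X(1) id by (fastforce simp: refl_on_def stabilizes_def)
  show "sym ?R"
  proof (rule symI, clarify)
    fix S S' f1 f0
    assume S: "S \<in> X" "S' \<in> X" and f: "two_alg_iso s1 s0 s1 s0 S S' f1 f0" "stabilizes Z f1 f0" "P f1 f0"
    \<comment> \<open>Extending structures have the full types as carriers, so
      \<open>inv_into\<close> on a carrier is plain \<open>inv\<close>, the form in which the
      hypothesis on \<open>P\<close> is stated.\<close>
    have bij: "bij f1" "bij f0"
      using f(1) S X(2,3) by (auto simp: two_alg_iso_def)
    then have "stabilizes Z (inv f1) (inv f0)"
      using f(2) by (auto simp: stabilizes_def bij_is_inj inv_f_eq)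
    moreover have "two_alg_iso s1 s0 s1 s0 S' S (inv f1) (inv f0)"
      using two_alg_iso_inv_into[OF f(1)] S X by auto
    ultimately show "\<exists>f1 f0. two_alg_iso s1 s0 s1 s0 S' S f1 f0 \<and> stabilizes Z f1 f0 \<and> P f1 f0"
      using inv[OF bij f(3)] by blast
  qed
  show "trans ?R"
  proof (rule transI, clarify)
    fix S S' S'' f1 f0 g1 g0
    assume f: "two_alg_iso s1 s0 s1 s0 S S' f1 f0" "stabilizes Z f1 f0" "P f1 f0"
      and g: "two_alg_iso s1 s0 s1 s0 S' S'' g1 g0" "stabilizes Z g1 g0" "P g1 g0"
    have "stabilizes Z (g1 \<circ> f1) (g0 \<circ> f0)"
      using f(2) g(2) by (auto simp: stabilizes_def)
    then show "\<exists>f1 f0. two_alg_iso s1 s0 s1 s0 S S'' f1 f0 \<and> stabilizes Z f1 f0 \<and> P f1 f0"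
      using two_alg_iso_comp[OF f(1) g(1)] comp[OF f(3) g(3)] by blast
  qed
qed

lemma equiv_equiv_rel: "equiv (extending_structures s1 s0 Z V1 V0 d) (equiv_rel s1 s0 Z V1 V0 d)"
  using equiv_stabilizing_iso[of "\<lambda>_ _. True" s1 s0 Z V1 V0 d]
  by (simp add: equiv_rel_def equivalent_structures_def)

lemma equiv_cohom_rel: "equiv (extending_structures s1 s0 Z V1 V0 d) (cohom_rel s1 s0 Z V1 V0 d)"
proof -
  \<comment> \<open>Each projection is unchanged by precomposition with \<open>f1\<close> or
    \<open>f0\<close>; evaluating this at the preimage of \<open>e\<close> gives the claim for the
    inverse.\<close>
  have "costabilizes Z V1 V0 (inv f1) (inv f0)"
    if "bij f1" "bij f0" "costabilizes Z V1 V0 f1 f0" for f1 f0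
    using that unfolding costabilizes_def by (metis bij_inv_eq_iff)
  then show ?thesis
    using equiv_stabilizing_iso[of "costabilizes Z V1 V0" s1 s0 Z V1 V0 d]
    by (simp add: cohom_rel_def cohomologous_structures_def costabilizes_def)
qed

section \<open>Projections along a complement\<close>

text \<open>Turns every fact about the projection onto \<open>V\<close> into one about the
  projection onto \<open>Z\<close>.\<close>

lemma complementary_commute: "complementary s V Z" if "complementary s Z V"
  using that unfolding complementary_def by (metis Int_commute add.commute)

lemma proj_along_eqI:
  assumes "vector_space s" "complementary s Z V" "v \<in> V" "e - v \<in> Z"
  shows "proj_along V Z e = v"
  unfolding proj_along_def
proof (rule the_equality)
  fix w assume "w \<in> V \<and> e - w \<in> Z"
  moreover have sub: "module.subspace s Z" "module.subspace s V" "Z \<inter> V = {0}"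
    using assms(2) by (auto simp: complementary_def)
  \<comment> \<open>Two candidate values differ by an element of \<open>V\<close>; this identity
    shows that the difference is in \<open>Z\<close> too, hence zero.\<close>
  moreover have "(e - v) - (e - w) = w - v" by simp
  ultimately have "w - v \<in> Z" "w - v \<in> V"
    using assms subspace_closed(4) by metis+
  then show "w = v"
    using sub(3) by (metis IntI eq_iff_diff_eq_0 singletonD)
qed (use assms in auto)

lemma
  assumes "vector_space s" "complementary s Z V"
  shows proj_along_in: "proj_along V Z e \<in> V"
    and proj_along_decomp: "proj_along Z V e + proj_along V Z e = e"
    and proj_along_add: "z \<in> Z \<Longrightarrow> v \<in> V \<Longrightarrow> proj_along V Z (z + v) = v"
proof -
  show add: "proj_along V Z (z + v) = v" if "z \<in> Z" "v \<in> V" for z v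
    using that assms by (intro proj_along_eqI) auto
  obtain z v where zv: "z \<in> Z" "v \<in> V" "e = z + v"
    using assms(2) unfolding complementary_def by blast
  then show "proj_along V Z e \<in> V"
    by (simp add: add)
  have "proj_along Z V e = z"
    using zv assms by (intro proj_along_eqI[OF _ complementary_commute]) auto
  then show "proj_along Z V e + proj_along V Z e = e"
    using zv by (simp add: add)
qed

lemma proj_along_on:
  assumes "vector_space s" "complementary s Z V"
  shows "v \<in> V \<Longrightarrow> proj_along V Z v = v" "z \<in> Z \<Longrightarrow> proj_along V Z z = 0"
proof -
  have "0 \<in> Z" "0 \<in> V"
    using assms by (auto simp: complementary_def intro: subspace_closed)
  then show "v \<in> V \<Longrightarrow> proj_along V Z v = v" "z \<in> Z \<Longrightarrow> proj_along V Z z = 0"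
    using proj_along_add[OF assms, of 0 v] proj_along_add[OF assms, of z 0] by auto
qed

text \<open>Linearity comes from uniqueness: the sum, or multiple, of the projections satisfies the
  two conditions that characterise the projection of the sum, or multiple.\<close>

lemma linear_map_on_proj_along:
  assumes "vector_space s" "complementary s Z V"
  shows "linear_map_on s s UNIV V (proj_along V Z)"
proof -
  interpret vector_space s by fact
  have sub: "subspace Z" "subspace V"
    using assms(2) by (auto simp: complementary_def)
  have Z: "e - proj_along V Z e \<in> Z" for e
    using proj_along_decomp[OF assms, of e] proj_along_in[OF assms(1) complementary_commute[OF assms(2)], of e]
    by (metis add_diff_cancel_right')
  have "proj_along V Z (x + y) = proj_along V Z x + proj_along V Z y" for x y
  proof (rule proj_along_eqI[OF assms])
    show "proj_along V Z x + proj_along V Z y \<in> V"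
      using sub proj_along_in[OF assms] by (intro subspace_add)
    have "(x - proj_along V Z x) + (y - proj_along V Z y) \<in> Z"
      using sub Z by (intro subspace_add)
    then show "x + y - (proj_along V Z x + proj_along V Z y) \<in> Z"
      by (simp add: algebra_simps)
  qed
  moreover have "proj_along V Z (s c x) = s c (proj_along V Z x)" for c x
  proof (rule proj_along_eqI[OF assms])
    show "s c (proj_along V Z x) \<in> V"
      using sub proj_along_in[OF assms] by (intro subspace_scale)
    have "s c (x - proj_along V Z x) \<in> Z"
      using sub Z by (intro subspace_scale)
    then show "s c x - s c (proj_along V Z x) \<in> Z"
      by (simp add: scale_right_diff_distrib)
  qed
  ultimately show ?thesis
    using proj_along_in[OF assms] by (simp add: linear_map_on_def)
qed

section \<open>Reading a datum off a bilinear operation\<close>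

text \<open>The values of \<open>f\<close> on \<open>Za\<close> and \<open>Zb\<close> are not
  recorded, as there \<open>f\<close> is the given operation of the 2-algebra. Restriction puts each
  field into the extensional sets \<open>bilinear_maps\<close>, where equality of functions is
  equality of maps.\<close>

definition datum_part_of ::
  "'a set \<Rightarrow> 'a set \<Rightarrow> 'b set \<Rightarrow> 'b set \<Rightarrow> 'c::ab_group_add set \<Rightarrow> 'c set \<Rightarrow> ('a \<Rightarrow> 'b \<Rightarrow> 'c) \<Rightarrow>
   ('a, 'b, 'c) datum_part"
where
  "datum_part_of Za Va Zb Vb Zc Vc f =
     \<lparr>rharp = (\<lambda>u\<in>Va. \<lambda>y\<in>Zb. proj_along Zc Vc (f u y)),
      lharp = (\<lambda>x\<in>Za. \<lambda>v\<in>Vb. proj_along Zc Vc (f x v)),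
      rtri = (\<lambda>x\<in>Za. \<lambda>v\<in>Vb. proj_along Vc Zc (f x v)),
      ltri = (\<lambda>u\<in>Va. \<lambda>y\<in>Zb. proj_along Vc Zc (f u y)),
      omega = (\<lambda>u\<in>Va. \<lambda>v\<in>Vb. proj_along Zc Vc (f u v)),
      ast = (\<lambda>u\<in>Va. \<lambda>v\<in>Vb. proj_along Vc Zc (f u v))\<rparr>"

text \<open>All six fields have this shape, a bilinear map restricted to two summands and followed
  by a linear projection.\<close>

lemma bilinear_maps_comp_restrict:
  assumes "bilinear_map_on sa sb sc UNIV UNIV UNIV f" "linear_map_on sc sc UNIV C p"
    and "vector_space sa" "module.subspace sa A" "vector_space sb" "module.subspace sb B"
  shows "(\<lambda>x\<in>A. \<lambda>y\<in>B. p (f x y)) \<in> bilinear_maps sa sb sc A B C"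
  using assms(1,2) subspace_closed[OF assms(3,4)] subspace_closed[OF assms(5,6)]
  by (auto simp: bilinear_maps_def bilinear_map_on_def linear_map_on_def Pi_iff PiE_iff
      extensional_def restrict_def)

lemma is_datum_part_datum_part_of:
  assumes "bilinear_map_on sa sb sc UNIV UNIV UNIV f"
    and "vector_space sa" "complementary sa Za Va" "vector_space sb" "complementary sb Zb Vb"
    and "vector_space sc" "complementary sc Zc Vc"
  shows "is_datum_part sa sb sc Za Va Zb Vb Zc Vc (datum_part_of Za Va Zb Vb Zc Vc f)"
proof -
  note maps = bilinear_maps_comp_restrict[OF assms(1)]
  note projV = maps[OF linear_map_on_proj_along[OF assms(6,7)]]
    and projZ = maps[OF linear_map_on_proj_along[OF assms(6) complementary_commute[OF assms(7)]]]
  show ?thesis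
    using assms(2-5) unfolding is_datum_part_def datum_part_of_def datum_part.select_convs
    by (intro conjI projV projZ) (auto simp: complementary_def)
qed

text \<open>In each of the three blocks involving \<open>V\<close>, the \<open>Zc\<close> and
  \<open>Vc\<close> components add up to the value of \<open>f\<close>; together with
  \<open>m x y\<close> these are the four terms of the bilinear expansion of
  \<open>f (x + u) (y + v)\<close>.\<close>

lemma unified_op_datum_part_of:
  assumes "bilinear_map_on sa sb sc UNIV UNIV UNIV f"
    and sc: "vector_space sc" "complementary sc Zc Vc"
    and "x \<in> Za" "u \<in> Va" "y \<in> Zb" "v \<in> Vb" "m x y = f x y"
  shows "unified_op m (datum_part_of Za Va Zb Vb Zc Vc f) x u y v = f (x + u) (y + v)"
proof -
  have "unified_op m (datum_part_of Za Va Zb Vb Zc Vc f) x u y v = f x y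
      + (proj_along Zc Vc (f x v) + proj_along Vc Zc (f x v))
      + (proj_along Zc Vc (f u y) + proj_along Vc Zc (f u y))
      + (proj_along Zc Vc (f u v) + proj_along Vc Zc (f u v))"
    using assms by (simp add: unified_op_def datum_part_of_def ac_simps)
  then show ?thesis
    by (simp add: proj_along_decomp[OF sc] bilinear_map_on_add[OF assms(1)])
qed

text \<open>All six maps of the datum have a zero argument here and vanish by bilinearity. Hence the
  unified product restricts to the given operations on \<open>Z\<close>.\<close>

lemma unified_op_zero:
  assumes "is_datum_part sa sb sc Za Va Zb Vb Zc Vc D"
    and "0 \<in> Va" "0 \<in> Vb" "x \<in> Za" "y \<in> Zb"
  shows "unified_op m D x 0 y 0 = m x y"
  using assms
  by (auto simp: unified_op_def is_datum_part_def bilinear_maps_def bilinear_map_on_zero)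

section \<open>Unified products versus extending structures\<close>

locale complemented_2_algebra =
  fixes s1 :: "'k::field \<Rightarrow> 'a::ab_group_add \<Rightarrow> 'a" and s0 :: "'k \<Rightarrow> 'b::ab_group_add \<Rightarrow> 'b"
    and Z :: "('a, 'b) two_alg" and V1 :: "'a set" and V0 :: "'b set" and d :: "'a \<Rightarrow> 'b"
  assumes vs: "vector_space s1" "vector_space s0"
    and Z: "zinbiel_2_algebra s1 s0 Z"
    and V: "two_vector_space s1 s0 V1 V0 d"
    and compl1: "complementary s1 (car1 Z) V1" and compl0: "complementary s0 (car0 Z) V0"
begin

lemmas compl1' = complementary_commute[OF compl1] and compl0' = complementary_commute[OF compl0]

lemmas proj_simps =
  proj_along_in[OF vs(1) compl1] proj_along_in[OF vs(1) compl1']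
  proj_along_in[OF vs(2) compl0] proj_along_in[OF vs(2) compl0']
  proj_along_decomp[OF vs(1) compl1] proj_along_decomp[OF vs(2) compl0]
  proj_along_add[OF vs(1) compl1] proj_along_add[OF vs(2) compl0]
  proj_along_on[OF vs(1) compl1] proj_along_on[OF vs(1) compl1']
  proj_along_on[OF vs(2) compl0] proj_along_on[OF vs(2) compl0']

lemma linear_d: "linear_map_on s1 s0 V1 V0 d"
  using V by (simp add: two_vector_space_def)

lemma subspaces:
  "module.subspace s1 (car1 Z)" "module.subspace s0 (car0 Z)"
  "module.subspace s1 V1" "module.subspace s0 V0"
  using compl1 compl0 by (auto simp: complementary_def)

lemma zero_in: "0 \<in> V1" "0 \<in> V0"
  using subspaces subspace_closed(1) vs by auto

text \<open>Being a Zinbiel 2-algebra is built into \<open>ZZ\<close>, so what remains is that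
  \<open>Z\<close> is a subalgebra and that the structure map is compatible with
  \<open>d\<close>.\<close>

lemma unified_product_in_extending_structures:
  assumes "D \<in> ZZ s1 s0 Z V1 V0 d"
  shows "unified_product Z V1 V0 d D \<in> extending_structures s1 s0 Z V1 V0 d"
proof -
  let ?U = "unified_product Z V1 V0 d D"
  have D: "extending_datum s1 s0 Z V1 V0 D" and U: "zinbiel_2_algebra s1 s0 ?U"
    using assms by (auto simp: ZZ_def)
  have parts: "is_datum_part s0 s0 s0 (car0 Z) V0 (car0 Z) V0 (car0 Z) V0 (part0 D)"
    "is_datum_part s1 s1 s1 (car1 Z) V1 (car1 Z) V1 (car1 Z) V1 (part1 D)"
    "is_datum_part s0 s1 s1 (car0 Z) V0 (car1 Z) V1 (car1 Z) V1 (part2 D)"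
    "is_datum_part s1 s0 s1 (car1 Z) V1 (car0 Z) V0 (car1 Z) V1 (part3 D)"
    and sigma: "linear_map_on s1 s0 V1 (car0 Z) (sigma D)"
    using D by (auto simp: extending_datum_def)
  have "two_subalgebra s1 s0 Z ?U"
    using Z U parts[THEN unified_op_zero] zero_in
      linear_map_on_zero[OF sigma] linear_map_on_zero[OF linear_d]
    by (auto simp: two_subalgebra_def unified_product_def Let_def proj_simps)
  \<comment> \<open>Both \<open>bdry Z\<close> and \<open>sigma D\<close> take values in
    \<open>car0 Z\<close>, so the \<open>V0\<close> part of the structure map is exactly the
    \<open>d\<close> term.\<close>
  moreover have "proj_along V0 (car0 Z) (bdry ?U e) = d (proj_along V1 (car1 Z) e)" for e
  proof -
    have "bdry Z (proj_along (car1 Z) V1 e) + sigma D (proj_along V1 (car1 Z) e) \<in> car0 Z"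
      using zinbiel_2_algebra_bdry[OF Z] sigma subspace_closed(2)[OF vs(2) subspaces(2)]
      by (auto simp: linear_map_on_def Pi_iff proj_simps)
    moreover have "d (proj_along V1 (car1 Z) e) \<in> V0"
      using linear_d by (auto simp: linear_map_on_def Pi_iff proj_simps)
    ultimately show ?thesis
      by (simp add: unified_product_def Let_def proj_simps)
  qed
  ultimately show ?thesis
    using U by (simp add: extending_structures_def unified_product_def Let_def)
qed

text \<open>The section of the unified product construction. Only the \<open>car0 Z\<close> part of
  the structure map on \<open>V1\<close> enters, as \<open>sigma\<close>; its \<open>V0\<close> part
  is forced to be \<open>d\<close>.\<close>

definition datum_of :: "('a, 'b) two_alg \<Rightarrow> ('a, 'b) ext_datum" where
  "datum_of S =
     \<lparr>part0 = datum_part_of (car0 Z) V0 (car0 Z) V0 (car0 Z) V0 (mult0 S),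
      part1 = datum_part_of (car1 Z) V1 (car1 Z) V1 (car1 Z) V1 (mult1 S),
      part2 = datum_part_of (car0 Z) V0 (car1 Z) V1 (car1 Z) V1 (lact S),
      part3 = datum_part_of (car1 Z) V1 (car0 Z) V0 (car1 Z) V1 (ract S),
      sigma = (\<lambda>u\<in>V1. proj_along (car0 Z) V0 (bdry S u))\<rparr>"

lemma unified_product_datum_of:
  assumes S: "S \<in> extending_structures s1 s0 Z V1 V0 d"
  shows "unified_product Z V1 V0 d (datum_of S) = S"
proof -
  note S' = extending_structuresD[OF S]
  note bil = zinbiel_2_algebra_bilinear[OF S'(1), unfolded S'(2,3)]
  have lin: "linear_map_on s1 s0 UNIV UNIV (bdry S)"
    using zinbiel_2_algebra_bdry[OF S'(1)] S' by simp
  have sub: "two_subalgebra s1 s0 Z S"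
    and proj: "proj_along V0 (car0 Z) (bdry S e) = d (proj_along V1 (car1 Z) e)" for e
    using S by (auto simp: extending_structures_def)
  \<comment> \<open>The middle summand is the \<open>sigma\<close> of \<open>datum_of S\<close>, so
    the left side is the structure map of the unified product at \<open>e\<close>.\<close>
  have bdry: "bdry Z (proj_along (car1 Z) V1 e) + proj_along (car0 Z) V0 (bdry S (proj_along V1 (car1 Z) e))
      + d (proj_along V1 (car1 Z) e) = bdry S e" for e
  proof -
    let ?z = "proj_along (car1 Z) V1 e" and ?v = "proj_along V1 (car1 Z) e"
    have "d ?v = proj_along V0 (car0 Z) (bdry S ?v)"
      by (simp add: proj proj_simps)
    moreover have "bdry Z ?z = bdry S ?z"
      using sub by (simp add: two_subalgebra_def proj_simps)
    \<comment> \<open>\<open>proj_simps(5)\<close> is the decomposition of \<open>e\<close> as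
      \<open>?z + ?v\<close>.\<close>
    moreover have "bdry S e = bdry S ?z + bdry S ?v"
      using lin by (metis UNIV_I linear_map_on_def proj_simps(5))
    ultimately show ?thesis
      by (simp add: add.assoc proj_simps)
  qed
  show ?thesis
    using sub bdry S'
    by (simp add: unified_product_def datum_of_def Let_def two_subalgebra_def proj_simps
        unified_op_datum_part_of[OF bil(1) vs(1) compl1]
        unified_op_datum_part_of[OF bil(2) vs(2) compl0]
        unified_op_datum_part_of[OF bil(3) vs(1) compl1]
        unified_op_datum_part_of[OF bil(4) vs(1) compl1])
qed

text \<open>The unified product of \<open>datum_of S\<close> is \<open>S\<close> itself, so the
  2-algebra condition in \<open>ZZ\<close> is inherited and only linearity and the ranges of the
  maps are to be checked.\<close>

lemma datum_of_in_ZZ: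
  assumes S: "S \<in> extending_structures s1 s0 Z V1 V0 d"
  shows "datum_of S \<in> ZZ s1 s0 Z V1 V0 d"
proof -
  note S' = extending_structuresD[OF S]
  note bil = zinbiel_2_algebra_bilinear[OF S'(1), unfolded S'(2,3)]
  have "linear_map_on s1 s0 V1 (car0 Z) (\<lambda>u\<in>V1. proj_along (car0 Z) V0 (bdry S u))"
    using zinbiel_2_algebra_bdry[OF S'(1)] linear_map_on_proj_along[OF vs(2) compl0']
      subspace_closed[OF vs(1) subspaces(3)] S'
    by (simp add: linear_map_on_def Pi_iff)
  then have "extending_datum s1 s0 Z V1 V0 (datum_of S)"
    using bil vs compl1 compl0
    by (auto simp: extending_datum_def datum_of_def proj_simps intro!: is_datum_part_datum_part_of)
  then show ?thesis
    using S' by (simp add: ZZ_def unified_product_datum_of[OF S])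
qed

lemma image_unified_product:
  "unified_product Z V1 V0 d ` ZZ s1 s0 Z V1 V0 d = extending_structures s1 s0 Z V1 V0 d"
  using unified_product_in_extending_structures unified_product_datum_of datum_of_in_ZZ
  by (auto simp: image_iff) metis

end

theorem theorem2p6:
  fixes s1 :: "'k::alg_closed_field \<Rightarrow> 'e1::ab_group_add \<Rightarrow> 'e1"
    and s0 :: "'k \<Rightarrow> 'e0::ab_group_add \<Rightarrow> 'e0"
    and Z :: "('e1, 'e0) two_alg"
    and V1 :: "'e1 set" and V0 :: "'e0 set" and d :: "'e1 \<Rightarrow> 'e0"
  assumes "CHAR('k) \<noteq> 2" and "CHAR('k) \<noteq> 3"
    and "vector_space s1" and "vector_space s0"
    and "zinbiel_2_algebra s1 s0 Z"
    and "two_vector_space s1 s0 V1 V0 d"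
    and "complementary s1 (car1 Z) V1" and "complementary s0 (car0 Z) V0"
  shows
    "(\<exists>F. (\<forall>D\<in>ZZ s1 s0 Z V1 V0 d.
             F (datum_equiv_rel s1 s0 Z V1 V0 d `` {D}) =
             equiv_rel s1 s0 Z V1 V0 d `` {unified_product Z V1 V0 d D}) \<and>
          bij_betw F (HE2 s1 s0 Z V1 V0 d) (Extd s1 s0 Z V1 V0 d)) \<and>
     (\<exists>F. (\<forall>D\<in>ZZ s1 s0 Z V1 V0 d.
             F (datum_cohom_rel s1 s0 Z V1 V0 d `` {D}) =
             cohom_rel s1 s0 Z V1 V0 d `` {unified_product Z V1 V0 d D}) \<and>
          bij_betw F (HC2 s1 s0 Z V1 V0 d) (Extd' s1 s0 Z V1 V0 d))"
proof -
  interpret complemented_2_algebra s1 s0 Z V1 V0 d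
    using assms by (intro complemented_2_algebra.intro)
  \<comment> \<open>\<open>equiv_rel\<close> also demands that both unified products be extending
    structures, which holds for data in \<open>ZZ\<close>; so this relation is a preimage as the
    quotient lemma requires.\<close>
  have "datum_equiv_rel s1 s0 Z V1 V0 d =
      {(D, D'). D \<in> ZZ s1 s0 Z V1 V0 d \<and> D' \<in> ZZ s1 s0 Z V1 V0 d \<and>
        (unified_product Z V1 V0 d D, unified_product Z V1 V0 d D') \<in> equiv_rel s1 s0 Z V1 V0 d}"
    using unified_product_in_extending_structures
    by (auto simp: datum_equiv_rel_def equiv_rel_def)
  moreover have "datum_cohom_rel s1 s0 Z V1 V0 d =
      {(D, D'). D \<in> ZZ s1 s0 Z V1 V0 d \<and> D' \<in> ZZ s1 s0 Z V1 V0 d \<and>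
        (unified_product Z V1 V0 d D, unified_product Z V1 V0 d D') \<in> cohom_rel s1 s0 Z V1 V0 d}"
    using unified_product_in_extending_structures
    by (auto simp: datum_cohom_rel_def cohom_rel_def)
  ultimately show ?thesis
    unfolding HE2_def HC2_def Extd_def Extd'_def
    by (intro conjI quotient_bij_betw_pullback equiv_equiv_rel equiv_cohom_rel image_unified_product)
qed

end
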